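(* The longest cubefree word over the binary alphabet $\{0,1\}$ whose curling-number transform is overlap-free has length $13$. That is, there exists a cubefree binary word $x$ of length $13$ with $C(x)$ overlap-free, and there is no such word of length greater than $13$.
   Context: Words are indexed from $0$: a finite word of length $n$ is $x = x[0]x[1]\cdots x[n-1]$, and $x[i..j]$ denotes the factor (contiguous block) $x[i]\cdots x[j]$. A word is cubefree if it contains no factor of the form $yyy$ with $y$ a nonempty word. An overlap is a word of the form $a x a x a$ with $a$ a single letter and $x$ a possibly empty word; a word is overlap-free if it contains no overlap as a factor. The curling number of a nonempty finite word $u$ is the largest integer $k \ge 1$ such that $u = y z^k$ for some (possibly empty) word $y$ and some nonempty word $z$. For a finite or infinite word $x$, the curling-number transform $C(x)$ is the word over the positive integers, of the same length as $x$, whose $i$-th letter $C(x)[i]$ is the curling number of the prefix $x[0..i]$. *)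

theory Defs
  imports "HOL-Library.Sublist"
begin

definition word_pow :: "'a list \<Rightarrow> nat \<Rightarrow> 'a list" where
  "word_pow z k = concat (replicate k z)"

definition cubefree :: "'a list \<Rightarrow> bool" where
  "cubefree x \<longleftrightarrow> \<not> (\<exists>y. y \<noteq> [] \<and> sublist (y @ y @ y) x)"

definition overlap :: "'a list \<Rightarrow> bool" where
  "overlap w \<longleftrightarrow> (\<exists>a x. w = [a] @ x @ [a] @ x @ [a])"

definition overlap_free :: "'a list \<Rightarrow> bool" where
  "overlap_free x \<longleftrightarrow> \<not> (\<exists>w. overlap w \<and> sublist w x)"

text \<open>
  Only meaningful for nonempty u: then the candidates for k include 1 and are bounded by the
  length of u, so the greatest one exists.
\<close>

definition curling_number :: "'a list \<Rightarrow> nat" where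
  "curling_number u = (GREATEST k. k \<ge> 1 \<and> (\<exists>y z. z \<noteq> [] \<and> u = y @ word_pow z k))"

definition curling_transform :: "'a list \<Rightarrow> nat list" where
  "curling_transform x = map (\<lambda>i. curling_number (take (Suc i) x)) [0..<length x]"

end

theory Submission
  imports Defs
begin

text \<open>
  Cubefreeness of a word and overlap-freeness of its curling-number transform pass to prefixes, so
  the admissible words form a tree under extension by one letter. In a cubefree word every curling
  number is 1 or 2, and it is 2 exactly if the prefix in question ends in a square. Hence the tree
  can be searched exhaustively, checking only for cubes and overlaps that end at the newest
  letter: it is nonempty at depth 13 and empty at depth 14. All words are kept reversed, so that
  extension is \<open>Cons\<close> and suffixes become prefixes.
\<close>

text \<open>Letting \<open>z\<close> range over the finite list \<open>prefixes w\<close> loses no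
  repetition and keeps this predicate and the next two executable.\<close>

definition square_prefix :: "'a list \<Rightarrow> bool" where
  "square_prefix w \<longleftrightarrow> (\<exists>z \<in> set (prefixes w). z \<noteq> [] \<and> prefix (z @ z) w)"

definition cube_prefix :: "'a list \<Rightarrow> bool" where
  "cube_prefix w \<longleftrightarrow> (\<exists>z \<in> set (prefixes w). z \<noteq> [] \<and> prefix (z @ z @ z) w)"

text \<open>With \<open>z = a # x\<close>, the overlap \<open>a x a x a\<close> is
  \<open>z z\<close> followed by the first letter of \<open>z\<close>.\<close>

definition overlap_prefix :: "'a list \<Rightarrow> bool" where
  "overlap_prefix w \<longleftrightarrow> (\<exists>z \<in> set (prefixes w). z \<noteq> [] \<and> prefix (z @ z @ [hd z]) w)"

primrec rev_curling :: "'a list \<Rightarrow> nat list" where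
  "rev_curling [] = []"
| "rev_curling (a # w) = (if square_prefix (a # w) then 2 else 1) # rev_curling w"

primrec admissible_words :: "nat \<Rightarrow> nat list list" where
  "admissible_words 0 = [[]]"
| "admissible_words (Suc n) =
     filter (\<lambda>w. \<not> cube_prefix w \<and> \<not> overlap_prefix (rev_curling w))
       (concat (map (\<lambda>w. [0 # w, 1 # w]) (admissible_words n)))"

lemma square_prefix_iff: "square_prefix w \<longleftrightarrow> (\<exists>z. z \<noteq> [] \<and> prefix (z @ z) w)"
  unfolding square_prefix_def by (metis append_prefixD in_set_prefixes)

lemma cube_prefix_iff: "cube_prefix w \<longleftrightarrow> (\<exists>z. z \<noteq> [] \<and> prefix (z @ z @ z) w)"
  unfolding cube_prefix_def by (metis append_prefixD in_set_prefixes)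

lemma overlap_prefix_iff: "overlap_prefix w \<longleftrightarrow> (\<exists>v. overlap v \<and> prefix v w)"
proof
  assume "overlap_prefix w"
  then obtain z where "z \<noteq> []" "prefix (z @ z @ [hd z]) w"
    unfolding overlap_prefix_def by blast
  moreover from \<open>z \<noteq> []\<close> have "overlap (z @ z @ [hd z])"
    unfolding overlap_def by (intro exI[of _ "hd z"] exI[of _ "tl z"]) simp
  ultimately show "\<exists>v. overlap v \<and> prefix v w" by blast
next
  assume "\<exists>v. overlap v \<and> prefix v w"
  then obtain a x where "prefix ((a # x) @ (a # x) @ [hd (a # x)]) w"
    unfolding overlap_def by auto
  then show "overlap_prefix w"
    unfolding overlap_prefix_def by (metis append_prefixD in_set_prefixes list.discI)
qed

lemma cubefree_rev: "cubefree (rev w) = cubefree w"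
proof -
  have "cubefree (rev v)" if "cubefree v" for v :: "'a list"
    using that unfolding cubefree_def
    by (metis append_assoc rev_append rev_is_Nil_conv rev_rev_ident sublist_rev_right)
  from this[of w] this[of "rev w"] show ?thesis by auto
qed

lemma overlap_rev: "overlap (rev w) = overlap w"
proof -
  have "overlap (rev v)" if v: "overlap v" for v :: "'a list"
  proof -
    from v obtain a x where "v = [a] @ x @ [a] @ x @ [a]"
      unfolding overlap_def by blast
    then have "rev v = [a] @ rev x @ [a] @ rev x @ [a]" by simp
    then show ?thesis unfolding overlap_def by blast
  qed
  from this[of w] this[of "rev w"] show ?thesis by auto
qed

lemma overlap_free_rev: "overlap_free (rev w) = overlap_free w"
  unfolding overlap_free_def by (metis overlap_rev rev_rev_ident sublist_rev_right)

lemma cubefree_Nil: "cubefree []"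
  by (simp add: cubefree_def)

lemma overlap_free_Nil: "overlap_free []"
  by (auto simp: overlap_free_def overlap_def)

text \<open>A factor of \<open>a # w\<close> either is a prefix of it or already lies in
  \<open>w\<close>, so only cubes starting at the new letter need a test.\<close>

lemma cubefree_Cons: "cubefree (a # w) \<longleftrightarrow> \<not> cube_prefix (a # w) \<and> cubefree w"
  unfolding cubefree_def cube_prefix_iff sublist_Cons_right by blast

lemma overlap_free_Cons: "overlap_free (a # w) \<longleftrightarrow> \<not> overlap_prefix (a # w) \<and> overlap_free w"
  unfolding overlap_free_def overlap_prefix_iff sublist_Cons_right by blast

text \<open>An exponent of 3 or more would put a cube at the end of \<open>u\<close>. Exponent 1 is
  always attained, by \<open>u\<close> itself, and exponent 2 exactly when \<open>u\<close> ends in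
  a square.\<close>

lemma curling_number_cubefree:
  assumes "cubefree u" and "u \<noteq> []"
  shows "curling_number u = (if square_prefix (rev u) then 2 else 1)"
proof -
  let ?P = "\<lambda>k. k \<ge> 1 \<and> (\<exists>y z. z \<noteq> [] \<and> u = y @ word_pow z k)"
  have sq: "square_prefix (rev u) \<longleftrightarrow> (\<exists>y z. z \<noteq> [] \<and> u = y @ z @ z)"
  proof -
    \<comment> \<open>Naming the root \<open>rev z\<close> makes the square a reversed word, so that
      being a prefix of \<open>rev u\<close> turns into being a suffix of \<open>u\<close>.\<close>
    have "square_prefix (rev u) \<longleftrightarrow> (\<exists>z. rev z \<noteq> [] \<and> prefix (rev (z @ z)) (rev u))"
      unfolding square_prefix_iff by (metis rev_append rev_rev_ident)
    then show ?thesis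
      by (auto simp: suffix_to_prefix[symmetric] suffix_def simp del: rev_append)
  qed
  have two: "word_pow z 2 = z @ z" for z :: "'a list"
    by (simp add: word_pow_def numeral_2_eq_2)
  have le2: "k \<le> 2" if "?P k" for k
  proof (rule ccontr)
    assume "\<not> k \<le> 2"
    \<comment> \<open>The subtraction is exact since \<open>k > 2\<close>; three copies of
      \<open>z\<close> split off and form a cube inside \<open>u\<close>.\<close>
    then have "k = Suc (Suc (Suc (k - 3)))" by simp
    with that obtain y z where "z \<noteq> []" "u = y @ (z @ z @ z) @ word_pow z (k - 3)"
      unfolding word_pow_def by (metis append_assoc concat.simps(2) replicate_Suc)
    then show False
      using assms(1) unfolding cubefree_def by (metis sublist_appendI)
  qed
  show ?thesis
  proof (cases "square_prefix (rev u)")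
    case True
    then have "?P 2" using sq two by auto
    then have "curling_number u = 2"
      unfolding curling_number_def by (rule Greatest_equality) (rule le2)
    with True show ?thesis by simp
  next
    case False
    then have "\<not> ?P 2" using sq two by auto
    then have le1: "k \<le> 1" if "?P k" for k
      using le2[OF that] that by (cases "k = 2") auto
    have "u = [] @ word_pow u 1" by (simp add: word_pow_def)
    with assms(2) have "?P 1" by blast
    then have "curling_number u = 1"
      unfolding curling_number_def by (rule Greatest_equality) (rule le1)
    with False show ?thesis by simp
  qed
qed

text \<open>Each letter of the transform depends only on the prefix ending at its position, so
  truncation commutes with the transform.\<close>

lemma curling_transform_take: "curling_transform (take n x) = take n (curling_transform x)"
  unfolding curling_transform_def by (rule nth_equalityI) auto

lemma curling_transform_snoc:
  "curling_transform (u @ [a]) = curling_transform u @ [curling_number (u @ [a])]"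
  unfolding curling_transform_def by simp

lemma curling_transform_rev:
  "cubefree w \<Longrightarrow> curling_transform (rev w) = rev (rev_curling w)"
proof (induction w)
  case Nil
  then show ?case by (simp add: curling_transform_def)
next
  case (Cons a w)
  have "curling_number (rev (a # w)) = (if square_prefix (a # w) then 2 else 1)"
    using curling_number_cubefree[of "rev (a # w)"] Cons.prems cubefree_rev[of "a # w"] by simp
  with Cons show ?case
    by (simp add: curling_transform_snoc cubefree_Cons)
qed

lemma set_admissible_words:
  "set (admissible_words n) =
     {w. set w \<subseteq> {0, 1} \<and> length w = n \<and> cubefree w \<and> overlap_free (rev_curling w)}"
proof (induction n)
  case 0
  show ?case by (auto simp: cubefree_Nil overlap_free_Nil)
next
  case (Suc n)
  have step: "w \<in> set (admissible_words (Suc n)) \<longleftrightarrow>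
      (\<exists>a v. w = a # v \<and> a \<in> {0, 1} \<and> v \<in> set (admissible_words n) \<and>
        \<not> cube_prefix w \<and> \<not> overlap_prefix (rev_curling w))" for w
    by auto
  show ?case
    unfolding set_eq_iff step Suc.IH
    by (auto simp: length_Suc_conv cubefree_Cons overlap_free_Cons)
qed

text \<open>This translates the search on reversed words back to the original notions. Cubefreeness
  comes first, because \<open>rev_curling\<close> is tied to the true transform only for cubefree
  words.\<close>

lemma admissible_words_iff:
  "rev x \<in> set (admissible_words n) \<longleftrightarrow>
     set x \<subseteq> {0, 1} \<and> length x = n \<and> cubefree x \<and> overlap_free (curling_transform x)"
proof -
  have "overlap_free (rev_curling (rev x)) = overlap_free (curling_transform x)" if "cubefree x"
    using curling_transform_rev[of "rev x"] that
    by (simp add: cubefree_rev overlap_free_rev)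
  then show ?thesis by (auto simp: set_admissible_words cubefree_rev)
qed

lemma admissible_words_13: "admissible_words 13 \<noteq> []"
  by code_simp

text \<open>The exhaustive search itself, by evaluation: no admissible word of length 13 can be
  extended.\<close>

lemma admissible_words_14: "admissible_words 14 = []"
  by code_simp

theorem theorem4:
  shows "(\<exists>x :: nat list. set x \<subseteq> {0, 1} \<and> length x = 13 \<and> cubefree x
            \<and> overlap_free (curling_transform x))
       \<and> \<not> (\<exists>x :: nat list. set x \<subseteq> {0, 1} \<and> length x > 13 \<and> cubefree x
            \<and> overlap_free (curling_transform x))"
proof
  obtain w where "w \<in> set (admissible_words 13)"
    using admissible_words_13 by (cases "admissible_words 13") auto
  then have "rev (rev w) \<in> set (admissible_words 13)" by simp
  then show "\<exists>x :: nat list. set x \<subseteq> {0, 1} \<and> length x = 13 \<and> cubefree x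
            \<and> overlap_free (curling_transform x)"
    unfolding admissible_words_iff by blast
next
  show "\<not> (\<exists>x :: nat list. set x \<subseteq> {0, 1} \<and> length x > 13 \<and> cubefree x
            \<and> overlap_free (curling_transform x))"
  proof
    assume "\<exists>x :: nat list. set x \<subseteq> {0, 1} \<and> length x > 13 \<and> cubefree x
            \<and> overlap_free (curling_transform x)"
    then obtain x :: "nat list" where x: "set x \<subseteq> {0, 1}" "length x > 13" "cubefree x"
      "overlap_free (curling_transform x)" by blast
    \<comment> \<open>All four conditions pass to the prefix of length 14, so one empty level
      excludes every greater length.\<close>
    have "set (take 14 x) \<subseteq> {0, 1}" using x(1) set_take_subset by fast
    moreover have "length (take 14 x) = 14" using x(2) by simp
    moreover have "cubefree (take 14 x)"
      using x(3) unfolding cubefree_def by (meson sublist_order.order_trans sublist_take)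
    moreover have "overlap_free (curling_transform (take 14 x))"
      using x(4) unfolding curling_transform_take overlap_free_def
      by (meson sublist_order.order_trans sublist_take)
    ultimately have "rev (take 14 x) \<in> set (admissible_words 14)"
      unfolding admissible_words_iff by blast
    then show False by (simp add: admissible_words_14)
  qed
qed

end
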